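(* (Negative Burg entropy.) Let $n\in\mathbb N$, let $X:=\mathbb R^n$ with an arbitrary norm $\|\cdot\|$, let $U:=(0,\infty)^n$, and define $b:X\to(-\infty,\infty]$ by $b(x):=-\sum_{k=1}^n\log(x_k)$ for $x\in U$ and $b(x):=\infty$ for $x\notin U$. Then: (a) $b$ is strongly convex on every nonempty, bounded, closed and convex subset $S$ of $U$, with $\mu[S]:=c_2^2/(c_\infty^2M_S^2)$ as a strong convexity parameter, where $M_S>0$ is an upper bound on the norms $\|\cdot\|$ of vectors in $S$ and $c_2,c_\infty>0$ are constants with $c_2\|v\|\le\|v\|_2$ and $\|v\|_\infty\le c_\infty\|v\|$ for all $v\in X$. (b) For each $x\in U$ there is $r_x>0$ such that $b$ is uniformly convex relative to $(\{x\},\{w\in U:\|w\|>r_x\})$ with $\psi(t):=\frac14\log(1+t)$, $t\in[0,\infty)$, as a relative gauge. (c) $b$ is not uniformly convex on $U$. (d) $b$ is a sequentially consistent Bregman function (with zone $U$) which satisfies the limiting difference property, and for all $y\in U$ and $\gamma\in\mathbb R$ the second type level-set $\{x\in\mathrm{dom}(b):B(x,y)\le\gamma\}$ is bounded.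
   Context: $\|v\|_2$ and $\|v\|_\infty$ are the Euclidean and max norms; $\log$ is the natural logarithm. $\mathrm{dom}(b):=\{x\in X:b(x)<\infty\}$. For convex $b$ and nonempty $S_1,S_2\subseteq\mathrm{dom}(b)$, $b$ is uniformly convex relative to $(S_1,S_2)$ with relative gauge $\psi:[0,\infty)\to[0,\infty]$ (where $\psi(t)>0$ for $t>0$) if $b(\lambda x+(1-\lambda)y)+\lambda(1-\lambda)\psi(\|x-y\|)\le\lambda b(x)+(1-\lambda)b(y)$ for all $\lambda\in(0,1)$, $(x,y)\in S_1\times S_2$. If $S_1=S_2=S$, $b$ is uniformly convex on $S$; if also $\psi(t)=\frac12\mu t^2$ with $\mu>0$, $b$ is strongly convex on $S$ with strong convexity parameter $\mu$. Divergence: $B(x,y):=b(x)-b(y)-\langle b'(y),x-y\rangle$ for $(x,y)\in\mathrm{dom}(b)\times U$, and $B(x,y):=\infty$ otherwise, where $b'$ is the (Gâteaux) derivative. $b$ is a Bregman function with zone $U$ if: (i) $U=\mathrm{Int}(\mathrm{dom}(b))\ne\emptyset$ and $b$ is Gâteaux differentiable in $U$; (ii) $b$ is convex and lower semicontinuous on $X$ and strictly convex on $\mathrm{dom}(b)$; (iii) for each $\gamma\in\mathbb R$ and $x\in\mathrm{dom}(b)$ the set $\{y\in U:B(x,y)\le\gamma\}$ is bounded; (iv) if $x\in\mathrm{dom}(b)$ and $(y_i)$ in $U$ satisfy $\|x-y_i\|\to0$, then $B(x,y_i)\to0$; (v) if $(x_i)$ is a bounded sequence in $\mathrm{dom}(b)$,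 $(y_i)$ is a sequence in $U$, $B(x_i,y_i)\to0$ and $\|y_i-y\|\to0$ for some $y\in\mathrm{dom}(b)$, then $\|x_i-y\|\to0$. $b$ has the limiting difference property if for each $x\in\mathrm{dom}(b)$ and each sequence $(y_i)$ in $U$ converging (weakly) to some $y\in U$, $B(x,y)=\lim_{i\to\infty}(B(x,y_i)-B(y,y_i))$. $b$ is sequentially consistent if for all sequences $(x_i)$ in $\mathrm{dom}(b)$ and $(y_i)$ in $U$ with $(y_i)$ bounded and $B(x_i,y_i)\to0$ one has $\|x_i-y_i\|\to0$. *)

theory Defs
  imports "HOL-Analysis.Analysis"
begin

text \<open>
  The norm of the ambient space is an arbitrary function \<open>N\<close> satisfying the norm axioms, in general
  different from the norm of the type class.  All metric and topological notions below are taken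
  with respect to \<open>N\<close>.
\<close>

definition is_norm :: "('a::real_vector \<Rightarrow> real) \<Rightarrow> bool" where
  "is_norm N \<longleftrightarrow>
     (\<forall>v. 0 \<le> N v) \<and> (\<forall>v. N v = 0 \<longleftrightarrow> v = 0) \<and>
     (\<forall>a v. N (a *\<^sub>R v) = \<bar>a\<bar> * N v) \<and> (\<forall>v w. N (v + w) \<le> N v + N w)"

definition norm_topology :: "('a::real_vector \<Rightarrow> real) \<Rightarrow> 'a topology" where
  "norm_topology N = Metric_space.mtopology UNIV (\<lambda>x y. N (x - y))"

definition norm_bounded :: "('a::real_vector \<Rightarrow> real) \<Rightarrow> 'a set \<Rightarrow> bool" where
  "norm_bounded N S \<longleftrightarrow> (\<exists>M. \<forall>x\<in>S. N x \<le> M)"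

definition norm_dual :: "('a::real_vector \<Rightarrow> real) \<Rightarrow> ('a \<Rightarrow> real) set" where
  "norm_dual N = {f. linear f \<and> (\<exists>K. \<forall>v. \<bar>f v\<bar> \<le> K * N v)}"

definition weakly_converges :: "('a::real_vector \<Rightarrow> real) \<Rightarrow> (nat \<Rightarrow> 'a) \<Rightarrow> 'a \<Rightarrow> bool" where
  "weakly_converges N ys y \<longleftrightarrow> (\<forall>f\<in>norm_dual N. (\<lambda>i. f (ys i)) \<longlonglongrightarrow> f y)"

definition edom :: "('a \<Rightarrow> ereal) \<Rightarrow> 'a set" where
  "edom b = {x. b x < \<infinity>}"

text \<open>Convexity is for functions with values in \<open>(-\<infinity>, \<infinity>]\<close>, so the value \<open>-\<infinity>\<close> is excluded.\<close>

definition ext_convex :: "('a::real_vector \<Rightarrow> ereal) \<Rightarrow> bool" where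
  "ext_convex b \<longleftrightarrow>
     (\<forall>x. b x \<noteq> -\<infinity>) \<and>
     (\<forall>x y. \<forall>l\<in>{0<..<1}.
        b (l *\<^sub>R x + (1 - l) *\<^sub>R y) \<le> ereal l * b x + ereal (1 - l) * b y)"

definition ext_strictly_convex_on :: "'a::real_vector set \<Rightarrow> ('a \<Rightarrow> ereal) \<Rightarrow> bool" where
  "ext_strictly_convex_on S b \<longleftrightarrow>
     (\<forall>x\<in>S. \<forall>y\<in>S. \<forall>l\<in>{0<..<1}. x \<noteq> y \<longrightarrow>
        b (l *\<^sub>R x + (1 - l) *\<^sub>R y) < ereal l * b x + ereal (1 - l) * b y)"

definition ext_lsc :: "('a::real_vector \<Rightarrow> real) \<Rightarrow> ('a \<Rightarrow> ereal) \<Rightarrow> bool" where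
  "ext_lsc N b \<longleftrightarrow>
     (\<forall>x a. a < b x \<longrightarrow> (\<exists>d>0. \<forall>y. N (y - x) < d \<longrightarrow> a < b y))"

text \<open>A gauge is a function on \<open>[0, \<infinity>)\<close>; its values at negative reals are irrelevant.\<close>

definition uniformly_convex_rel ::
  "('a::real_vector \<Rightarrow> real) \<Rightarrow> ('a \<Rightarrow> ereal) \<Rightarrow> 'a set \<Rightarrow> 'a set \<Rightarrow> (real \<Rightarrow> ereal) \<Rightarrow> bool" where
  "uniformly_convex_rel N b S1 S2 \<psi> \<longleftrightarrow>
     ext_convex b \<and>
     S1 \<noteq> {} \<and> S1 \<subseteq> edom b \<and> S2 \<noteq> {} \<and> S2 \<subseteq> edom b \<and>
     0 \<le> \<psi> 0 \<and> (\<forall>t>0. 0 < \<psi> t) \<and>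
     (\<forall>x\<in>S1. \<forall>y\<in>S2. \<forall>l\<in>{0<..<1}.
        b (l *\<^sub>R x + (1 - l) *\<^sub>R y) + ereal (l * (1 - l)) * \<psi> (N (x - y))
          \<le> ereal l * b x + ereal (1 - l) * b y)"

definition uniformly_convex_on :: "('a::real_vector \<Rightarrow> real) \<Rightarrow> ('a \<Rightarrow> ereal) \<Rightarrow> 'a set \<Rightarrow> bool" where
  "uniformly_convex_on N b S \<longleftrightarrow> (\<exists>\<psi>. uniformly_convex_rel N b S S \<psi>)"

definition strongly_convex_on ::
  "('a::real_vector \<Rightarrow> real) \<Rightarrow> ('a \<Rightarrow> ereal) \<Rightarrow> 'a set \<Rightarrow> real \<Rightarrow> bool" where
  "strongly_convex_on N b S \<mu> \<longleftrightarrow>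
     0 < \<mu> \<and> uniformly_convex_rel N b S S (\<lambda>t. ereal (1 / 2 * \<mu> * t\<^sup>2))"

text \<open>
  The difference quotient is formed in the extended reals, so that directions leaving the
  effective domain are not mistaken for directions along which the function has finite values.
\<close>

definition has_gateaux_derivative ::
  "('a::real_vector \<Rightarrow> real) \<Rightarrow> ('a \<Rightarrow> ereal) \<Rightarrow> ('a \<Rightarrow> real) \<Rightarrow> 'a \<Rightarrow> bool" where
  "has_gateaux_derivative N b D y \<longleftrightarrow>
     \<bar>b y\<bar> \<noteq> \<infinity> \<and> D \<in> norm_dual N \<and>
     (\<forall>v. ((\<lambda>t::real. (b (y + t *\<^sub>R v) - b y) / ereal t) \<longlongrightarrow> ereal (D v)) (at 0))"

definition gateaux_deriv :: "('a::real_vector \<Rightarrow> real) \<Rightarrow> ('a \<Rightarrow> ereal) \<Rightarrow> 'a \<Rightarrow> 'a \<Rightarrow> real" where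
  "gateaux_deriv N b y = (THE D. has_gateaux_derivative N b D y)"

definition divergence ::
  "('a::real_vector \<Rightarrow> real) \<Rightarrow> ('a \<Rightarrow> ereal) \<Rightarrow> 'a set \<Rightarrow> 'a \<Rightarrow> 'a \<Rightarrow> ereal" where
  "divergence N b U x y =
     (if x \<in> edom b \<and> y \<in> U then b x - b y - ereal (gateaux_deriv N b y (x - y)) else \<infinity>)"

definition bregman_function ::
  "('a::real_vector \<Rightarrow> real) \<Rightarrow> ('a \<Rightarrow> ereal) \<Rightarrow> 'a set \<Rightarrow> bool" where
  "bregman_function N b U \<longleftrightarrow>
     U = norm_topology N interior_of edom b \<and> U \<noteq> {} \<and>
     (\<forall>y\<in>U. \<exists>D. has_gateaux_derivative N b D y) \<and>
     ext_convex b \<and> ext_lsc N b \<and> ext_strictly_convex_on (edom b) b \<and>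
     (\<forall>\<gamma>::real. \<forall>x\<in>edom b. norm_bounded N {y \<in> U. divergence N b U x y \<le> ereal \<gamma>}) \<and>
     (\<forall>x\<in>edom b. \<forall>ys::nat \<Rightarrow> 'a. range ys \<subseteq> U \<and> (\<lambda>i. N (x - ys i)) \<longlonglongrightarrow> 0 \<longrightarrow>
        (\<lambda>i. divergence N b U x (ys i)) \<longlonglongrightarrow> 0) \<and>
     (\<forall>xs ys::nat \<Rightarrow> 'a. \<forall>y\<in>edom b.
        range xs \<subseteq> edom b \<and> norm_bounded N (range xs) \<and> range ys \<subseteq> U \<and>
        (\<lambda>i. divergence N b U (xs i) (ys i)) \<longlonglongrightarrow> 0 \<and> (\<lambda>i. N (ys i - y)) \<longlonglongrightarrow> 0 \<longrightarrow>
        (\<lambda>i. N (xs i - y)) \<longlonglongrightarrow> 0)"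

definition limiting_difference_property ::
  "('a::real_vector \<Rightarrow> real) \<Rightarrow> ('a \<Rightarrow> ereal) \<Rightarrow> 'a set \<Rightarrow> bool" where
  "limiting_difference_property N b U \<longleftrightarrow>
     (\<forall>x\<in>edom b. \<forall>ys::nat \<Rightarrow> 'a. \<forall>y\<in>U. range ys \<subseteq> U \<and> weakly_converges N ys y \<longrightarrow>
        (\<lambda>i. divergence N b U x (ys i) - divergence N b U y (ys i))
          \<longlonglongrightarrow> divergence N b U x y)"

definition sequentially_consistent ::
  "('a::real_vector \<Rightarrow> real) \<Rightarrow> ('a \<Rightarrow> ereal) \<Rightarrow> 'a set \<Rightarrow> bool" where
  "sequentially_consistent N b U \<longleftrightarrow>
     (\<forall>xs ys::nat \<Rightarrow> 'a.
        range xs \<subseteq> edom b \<and> range ys \<subseteq> U \<and> norm_bounded N (range ys) \<and>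
        (\<lambda>i. divergence N b U (xs i) (ys i)) \<longlonglongrightarrow> 0 \<longrightarrow>
        (\<lambda>i. N (xs i - ys i)) \<longlonglongrightarrow> 0)"

definition pos_orthant :: "(real ^ 'n) set" where
  "pos_orthant = {x. \<forall>k. 0 < x $ k}"

definition neg_burg :: "real ^ 'n \<Rightarrow> ereal" where
  "neg_burg x = (if x \<in> pos_orthant then ereal (- (\<Sum>k\<in>UNIV. ln (x $ k))) else \<infinity>)"

end

theory Submission
  imports Defs "HOL-Real_Asymp.Real_Asymp"
begin

text \<open>
  The negative Burg entropy is a sum of one-variable functions, so every claim about it is reduced
  to an inequality for the logarithm, applied in each coordinate.

  Convexity: the difference between the two sides of the convexity inequality at \<open>x\<close>, \<open>y\<close> is the sum
  over \<open>k\<close> of the Jensen gaps of \<open>ln\<close> at \<open>x\<^sub>k\<close>, \<open>y\<^sub>k\<close> (lemma \<open>neg_burg_jensen_iff\<close>).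
  On \<open>(0, R]\<close> the second derivative of \<open>- ln\<close> is at least \<open>1 / R\<^sup>2\<close>, which bounds the gap
  from below by a multiple of the squared difference (\<open>log_gap_ge_square\<close>); this is strong
  convexity on bounded sets, with \<open>R\<close> a bound for the max norm on the set.  If \<open>w\<close> is far from a fixed \<open>x\<close>, then some
  coordinate of \<open>w\<close> is comparable to its norm, and in that coordinate the gap is at least
  \<open>l (1 - l) ln (w\<^sub>k / (4 x\<^sub>k))\<close> (\<open>log_gap_ge_log\<close>), which
  eventually exceeds a quarter of a logarithm.  Uniform convexity on the whole orthant fails because
  the logarithm is asymptotically flat: along the diagonal, the gap of two points at a
  fixed distance tends to \<open>0\<close>.

  Bregman properties: the divergence is \<open>\<Sum>k. \<phi> (x\<^sub>k / y\<^sub>k)\<close>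
  with \<open>\<phi> s = s - 1 - ln s\<close> (\<open>divergence_neg_burg\<close>).  The function \<open>\<phi>\<close> is nonnegative and tends to infinity at
  both ends of \<open>(0, \<infinity>)\<close>, so a bound on the divergence confines each ratio
  \<open>x\<^sub>k / y\<^sub>k\<close> to a compact part of \<open>(0, \<infinity>)\<close>; this bounds both kinds of level
  sets.  It also satisfies \<open>(sqrt s - 1)\<^sup>2 \<le> \<phi> s\<close>, so that a vanishing divergence forces the
  ratios to \<open>1\<close>; this is sequential consistency, from which the last axiom of a Bregman function
  follows.  The remaining limits are instances of the continuity of the divergence in its second
  argument.

  The given norm matters only up to equivalence with the Euclidean norm, since boundedness, limits
  and the topology are the same for both (\<open>norm_equivalence\<close>).
\<close>

section \<open>Arbitrary norms on a Euclidean space\<close>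

lemma is_normD:
  assumes "is_norm N"
  shows norm_nonneg: "0 \<le> N v" and norm_zero_iff: "N v = 0 \<longleftrightarrow> v = 0"
    and norm_scale: "N (a *\<^sub>R v) = \<bar>a\<bar> * N v" and norm_triangle: "N (v + w) \<le> N v + N w"
  using assms by (auto simp: is_norm_def)

lemma norm_diff_le: "is_norm N \<Longrightarrow> N (v - w) \<le> N v + N w"
  using norm_triangle[of N v "- 1 *\<^sub>R w"] norm_scale[of N "- 1" w] by simp

lemma norm_minus_swap: "is_norm N \<Longrightarrow> N (v - w) = N (w - v)"
  using norm_scale[of N "- 1" "v - w"] by simp

lemma norm_sum_le: "is_norm N \<Longrightarrow> N (sum f A) \<le> (\<Sum>i\<in>A. N (f i))"
proof (induction A rule: infinite_finite_induct)
  case (insert x F)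
  then show ?case using norm_triangle[OF insert.prems, of "f x" "sum f F"] by simp
qed (use norm_zero_iff[of N 0] in auto)

lemma norm_le_euclidean:
  fixes N :: "'a::euclidean_space \<Rightarrow> real"
  assumes N: "is_norm N"
  shows "N v \<le> (\<Sum>b\<in>Basis. N b) * norm v"
proof -
  have "N v = N (\<Sum>b\<in>Basis. (v \<bullet> b) *\<^sub>R b)" by (simp add: euclidean_representation)
  also have "\<dots> \<le> (\<Sum>b\<in>Basis. N ((v \<bullet> b) *\<^sub>R b))" by (rule norm_sum_le[OF N])
  also have "\<dots> \<le> (\<Sum>b\<in>Basis. N b * norm v)"
    using Basis_le_norm[of _ v] norm_nonneg[OF N]
    by (intro sum_mono) (simp add: norm_scale[OF N] mult.commute mult_left_mono)
  finally show ?thesis by (simp add: sum_distrib_right)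
qed

lemma norm_continuous:
  fixes N :: "'a::euclidean_space \<Rightarrow> real"
  assumes N: "is_norm N"
  shows "continuous_on A N"
proof -
  let ?K = "\<Sum>b\<in>Basis. N b"
  have "?K-lipschitz_on A N"
  proof (rule lipschitz_onI)
    show "0 \<le> ?K" by (simp add: sum_nonneg norm_nonneg[OF N])
    fix x y
    have "N x \<le> N (x - y) + N y" "N y \<le> N (x - y) + N x"
      using norm_triangle[OF N, of "x - y" y] norm_triangle[OF N, of "y - x" x]
      by (simp_all add: norm_minus_swap[OF N, of y x])
    then show "dist (N x) (N y) \<le> ?K * dist x y"
      using norm_le_euclidean[OF N, of "x - y"] by (auto simp: dist_norm)
  qed
  then show ?thesis by (rule lipschitz_on_continuous_on)
qed

text \<open>
  The upper constant comes from expanding in the standard basis.  The lower one is the minimum of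
  the continuous function \<open>N\<close> on the compact Euclidean unit sphere.
\<close>

lemma norm_equivalence:
  fixes N :: "'a::euclidean_space \<Rightarrow> real"
  assumes N: "is_norm N"
  obtains c C where "c > 0" "C > 0" "\<And>v. c * N v \<le> norm v" "\<And>v. norm v \<le> C * N v"
proof -
  define K where "K = 1 + (\<Sum>b\<in>Basis. N b)"
  have K0: "K > 0" unfolding K_def by (intro add_pos_nonneg) (simp_all add: sum_nonneg norm_nonneg[OF N])
  have K: "N v \<le> K * norm v" for v
    using norm_le_euclidean[OF N, of v] norm_ge_zero[of v] unfolding K_def distrib_right by linarith
  have "sphere 0 1 \<noteq> ({} :: 'a set)" by simp
  then obtain u :: 'a where u: "norm u = 1" "\<And>v. norm v = 1 \<Longrightarrow> N u \<le> N v"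
    using continuous_attains_inf[of "sphere 0 1 :: 'a set" N] norm_continuous[OF N] by auto
  have "N u > 0"
    using u(1) norm_nonneg[OF N, of u] norm_zero_iff[OF N, of u] by force
  moreover have "norm v \<le> 1 / N u * N v" for v
  proof (cases "v = 0")
    case False
    then have "N u \<le> N ((1 / norm v) *\<^sub>R v)" by (intro u(2)) simp
    then show ?thesis using False \<open>N u > 0\<close> by (simp add: norm_scale[OF N] field_simps)
  qed (simp add: norm_nonneg[OF N])
  ultimately show ?thesis
    using K0 K by (intro that[of "1 / K" "1 / N u"]) (auto simp: field_simps)
qed

lemma norm_bounded_iff:
  fixes N :: "'a::euclidean_space \<Rightarrow> real"
  assumes N: "is_norm N"
  shows "norm_bounded N S \<longleftrightarrow> bounded S"
proof -
  obtain c C where c: "c > 0" "C > 0" "\<And>v. c * N v \<le> norm v" "\<And>v. norm v \<le> C * N v"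
    by (rule norm_equivalence[OF N], rule that)
  have "norm v \<le> C * M" if "N v \<le> M" for v M
    using c(4)[of v] mult_left_mono[OF that, of C] c(2) by linarith
  moreover have "N v \<le> M / c" if "norm v \<le> M" for v M
    using c(3)[of v] that c(1) by (simp add: field_simps)
  ultimately show ?thesis unfolding norm_bounded_def bounded_iff by meson
qed

lemma norm_tendsto_iff:
  fixes N :: "'a::euclidean_space \<Rightarrow> real"
  assumes N: "is_norm N"
  shows "((\<lambda>i. N (f i)) \<longlongrightarrow> 0) F \<longleftrightarrow> (f \<longlongrightarrow> 0) F"
proof
  obtain c C where c: "c > 0" "C > 0" "\<And>v. c * N v \<le> norm v" "\<And>v. norm v \<le> C * N v"
    by (rule norm_equivalence[OF N], rule that)
  assume "((\<lambda>i. N (f i)) \<longlongrightarrow> 0) F"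
  then have "((\<lambda>i. C * N (f i)) \<longlongrightarrow> 0) F" by (rule tendsto_mult_right_zero)
  then show "(f \<longlongrightarrow> 0) F" by (rule Lim_null_comparison[rotated]) (simp add: c)
next
  assume "(f \<longlongrightarrow> 0) F"
  then have "((\<lambda>i. N (f i)) \<longlongrightarrow> N 0) F"
    using norm_continuous[OF N, of UNIV]
    by (intro continuous_on_tendsto_compose[of UNIV N]) auto
  moreover have "N 0 = 0" by (simp add: norm_zero_iff[OF N])
  ultimately show "((\<lambda>i. N (f i)) \<longlongrightarrow> 0) F" by simp
qed

lemma norm_open_iff:
  fixes N :: "'a::euclidean_space \<Rightarrow> real"
  assumes N: "is_norm N"
  shows "open U \<longleftrightarrow> (\<forall>x\<in>U. \<exists>d>0. \<forall>y. N (y - x) < d \<longrightarrow> y \<in> U)"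
proof -
  obtain c C where c: "c > 0" "C > 0" "\<And>v. c * N v \<le> norm v" "\<And>v. norm v \<le> C * N v"
    by (rule norm_equivalence[OF N], rule that)
  have "norm v < e" if "N v < e / C" for v e
    using c(4)[of v] that c(2) by (simp add: field_simps)
  moreover have "N v < e" if "norm v < c * e" for v e
    using order.strict_trans1[OF c(3) that] c(1) by simp
  ultimately show ?thesis
    unfolding open_dist dist_norm using c(1,2) by (meson divide_pos_pos mult_pos_pos)
qed

lemma norm_topology_eq_euclidean:
  fixes N :: "'a::euclidean_space \<Rightarrow> real"
  assumes N: "is_norm N"
  shows "norm_topology N = euclidean"
proof -
  interpret Metric_space UNIV "\<lambda>x y. N (x - y)"
  proof
    fix x y z :: 'a
    show "N (x - z) \<le> N (x - y) + N (y - z)"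
      using norm_triangle[OF N, of "x - y" "y - z"] by simp
  qed (use N in \<open>simp_all add: norm_nonneg norm_zero_iff norm_minus_swap\<close>)
  show ?thesis
    unfolding topology_eq norm_topology_def openin_mtopology open_openin[symmetric]
      norm_open_iff[OF N] mball_def
    by (auto simp: norm_minus_swap[OF N] subset_iff)
qed

lemma linear_in_norm_dual:
  fixes N :: "'a::euclidean_space \<Rightarrow> real"
  assumes N: "is_norm N" and f: "linear f"
  shows "f \<in> norm_dual N"
proof -
  obtain c C where c: "c > 0" "C > 0" "\<And>v. c * N v \<le> norm v" "\<And>v. norm v \<le> C * N v"
    by (rule norm_equivalence[OF N], rule that)
  obtain B where B: "B > 0" "\<And>v. \<bar>f v\<bar> \<le> B * norm v"
    using linear_bounded_pos[OF f] by auto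
  have "\<bar>f v\<bar> \<le> B * C * N v" for v
  proof -
    have "\<bar>f v\<bar> \<le> B * norm v" by (rule B(2))
    also have "\<dots> \<le> B * (C * N v)" using B(1) c(4) by (intro mult_left_mono) auto
    finally show ?thesis by (simp only: mult.assoc)
  qed
  with f show ?thesis unfolding norm_dual_def by blast
qed

text \<open>
  Coordinates are bounded linear functionals, so weak convergence controls each of them.
\<close>

lemma weakly_converges_component:
  fixes N :: "real ^ 'n \<Rightarrow> real"
  assumes "is_norm N" "weakly_converges N ys y"
  shows "(\<lambda>i. ys i $ k) \<longlonglongrightarrow> y $ k"
proof -
  have "linear (\<lambda>v::real ^ 'n. v $ k)" by (simp add: bounded_linear.linear bounded_linear_vec_nth)
  then have "(\<lambda>v::real ^ 'n. v $ k) \<in> norm_dual N" by (rule linear_in_norm_dual[OF assms(1)])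
  from bspec[OF assms(2)[unfolded weakly_converges_def] this] show ?thesis .
qed

section \<open>The Jensen gap of the logarithm\<close>

definition log_gap :: "real \<Rightarrow> real \<Rightarrow> real \<Rightarrow> real" where
  "log_gap l a b = ln (l * a + (1 - l) * b) - l * ln a - (1 - l) * ln b"

lemma log_gap_swap: "log_gap (1 - l) b a = log_gap l a b"
  by (simp add: log_gap_def algebra_simps)

text \<open>
  The function \<open>- ln t - t\<^sup>2 / (2 R\<^sup>2)\<close> has derivative \<open>- 1 / t - t / R\<^sup>2\<close>, which is
  increasing on \<open>(0, R]\<close>, so it is convex there.  Its Jensen inequality is the claim, because the
  Jensen gap of the square is exactly \<open>l (1 - l) (a - b)\<^sup>2\<close>.
\<close>

lemma log_gap_ge_square:
  assumes "l \<in> {0<..<1}" "0 < a" "a \<le> R" "0 < b" "b \<le> R"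
  shows "l * (1 - l) * ((a - b)\<^sup>2 / (2 * R\<^sup>2)) \<le> log_gap l a b"
proof -
  let ?f = "\<lambda>t. - ln t - t\<^sup>2 / (2 * R\<^sup>2)"
  have R: "R > 0" using assms by simp
  have "convex_on {0<..R} ?f"
  proof (rule convex_on_realI)
    fix t assume "t \<in> {0<..R}"
    then show "(?f has_real_derivative - (1 / t) - t / R\<^sup>2) (at t)"
      using R by (auto intro!: derivative_eq_intros simp: field_simps)
  next
    fix s t assume st: "s \<in> {0<..R}" "t \<in> {0<..R}" "s \<le> t"
    have "s * t \<le> R\<^sup>2" using st by (simp add: power2_eq_square mult_mono)
    then have "(t - s) / R\<^sup>2 \<le> (t - s) / (s * t)"
      using st by (intro divide_left_mono) (auto simp: R)
    also have "\<dots> = 1 / s - 1 / t" using st by (simp add: field_simps)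
    finally show "- (1 / s) - s / R\<^sup>2 \<le> - (1 / t) - t / R\<^sup>2"
      by (simp add: diff_divide_distrib)
  qed simp
  from convex_onD[OF this, of "1 - l" a b] assms
  have "?f (l * a + (1 - l) * b) \<le> l * ?f a + (1 - l) * ?f b" by simp
  then have "(l * a\<^sup>2 + (1 - l) * b\<^sup>2 - (l * a + (1 - l) * b)\<^sup>2) / (2 * R\<^sup>2) \<le> log_gap l a b"
    by (simp add: log_gap_def algebra_simps add_divide_distrib diff_divide_distrib)
  also have "l * a\<^sup>2 + (1 - l) * b\<^sup>2 - (l * a + (1 - l) * b)\<^sup>2 = l * (1 - l) * (a - b)\<^sup>2"
    by (simp add: power2_eq_square algebra_simps)
  finally show ?thesis by simp
qed

lemma log_gap_nonneg:
  assumes "l \<in> {0<..<1}" "0 < a" "0 < b"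
  shows "0 \<le> log_gap l a b"
proof -
  have "0 \<le> l * (1 - l) * ((a - b)\<^sup>2 / (2 * (max a b)\<^sup>2))" using assms by simp
  also have "\<dots> \<le> log_gap l a b" by (rule log_gap_ge_square) (use assms in auto)
  finally show ?thesis .
qed

lemma log_gap_pos:
  assumes "l \<in> {0<..<1}" "0 < a" "0 < b" "a \<noteq> b"
  shows "0 < log_gap l a b"
proof -
  have "0 < l * (1 - l) * ((a - b)\<^sup>2 / (2 * (max a b)\<^sup>2))" using assms by auto
  also have "\<dots> \<le> log_gap l a b" by (rule log_gap_ge_square) (use assms in auto)
  finally show ?thesis .
qed

text \<open>
  As a function of \<open>l\<close> the gap is concave and vanishes at \<open>0\<close> and \<open>1\<close>.  Hence it lies above the
  tent with apex at \<open>l = 1 / 2\<close>, which has the value \<open>2 min l (1 - l)\<close> times the midpoint gap.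
  The tent is in turn replaced by the smooth lower bound \<open>2 l (1 - l)\<close>.
\<close>

lemma log_gap_ge_midpoint:
  assumes l: "l \<in> {0<..<1}" and "0 < a" "0 < b"
  shows "2 * l * (1 - l) * log_gap (1 / 2) a b \<le> log_gap l a b"
proof -
  have *: "2 * l * (1 - l) * log_gap (1 / 2) a b \<le> log_gap l a b"
    if l: "0 < l" "l \<le> 1 / 2" and ab: "0 < a" "0 < b" for l a b :: real
  proof -
    have g: "0 \<le> log_gap (1 / 2) a b" using ab by (intro log_gap_nonneg) auto
    \<comment> \<open>The point \<open>l a + (1 - l) b\<close> divides the segment from the midpoint to \<open>b\<close> in the ratio given by \<open>2 l\<close>.\<close>
    have "0 \<le> log_gap (2 * l) ((a + b) / 2) b"
    proof (cases "l = 1 / 2")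
      case True
      then have "2 * l = 1" by simp
      then show ?thesis by (simp add: log_gap_def)
    next
      case False
      then show ?thesis using l ab by (intro log_gap_nonneg) auto
    qed
    moreover have "2 * l * ((a + b) / 2) + (1 - 2 * l) * b = l * a + (1 - l) * b"
      by (simp add: algebra_simps)
    ultimately have "2 * l * log_gap (1 / 2) a b \<le> log_gap l a b"
      by (simp add: log_gap_def algebra_simps add_divide_distrib)
    moreover have "(2 * l * log_gap (1 / 2) a b) * (1 - l) \<le> (2 * l * log_gap (1 / 2) a b) * 1"
      using l g by (intro mult_left_mono) auto
    moreover have "(2 * l * log_gap (1 / 2) a b) * (1 - l) = 2 * l * (1 - l) * log_gap (1 / 2) a b"
      by (simp only: mult_ac)
    ultimately show ?thesis by linarith
  qed
  show ?thesis
  proof (cases "l \<le> 1 / 2")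
    case True
    then show ?thesis using * assms by simp
  next
    case False
    then have "2 * (1 - l) * (1 - (1 - l)) * log_gap (1 / 2) b a \<le> log_gap (1 - l) b a"
      using assms by (intro *) auto
    then show ?thesis
      using log_gap_swap[of "1 / 2" b a] by (simp add: log_gap_swap mult_ac)
  qed
qed

text \<open>
  The arithmetic mean of \<open>a\<close> and \<open>b\<close> is at least \<open>b / 2\<close>, so the midpoint gap is at least
  \<open>ln (b / 2) - (ln a + ln b) / 2 = ln (b / (4 a)) / 2\<close>.
\<close>

lemma log_gap_ge_log:
  assumes l: "l \<in> {0<..<1}" and "0 < a" "0 < b"
  shows "l * (1 - l) * ln (b / (4 * a)) \<le> log_gap l a b"
proof -
  have "ln (b / 2) \<le> ln ((a + b) / 2)" using assms by simp
  moreover have "ln (4::real) = 2 * ln 2" using ln_realpow[of 2 2] by simp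
  ultimately have "ln (b / (4 * a)) \<le> 2 * log_gap (1 / 2) a b"
    using assms by (simp add: log_gap_def ln_div ln_mult add_divide_distrib)
  then have "l * (1 - l) * ln (b / (4 * a)) \<le> l * (1 - l) * (2 * log_gap (1 / 2) a b)"
    using l by (intro mult_left_mono) auto
  also have "\<dots> = 2 * l * (1 - l) * log_gap (1 / 2) a b" by (simp only: mult_ac)
  also note log_gap_ge_midpoint[OF assms]
  finally show ?thesis .
qed

section \<open>Convexity of the negative Burg entropy\<close>

lemma edom_neg_burg: "edom neg_burg = (pos_orthant :: (real ^ 'n) set)"
  by (auto simp: edom_def neg_burg_def)

lemma open_pos_orthant: "open (pos_orthant :: (real ^ 'n) set)"
proof -
  have "pos_orthant = (\<Inter>k. {x :: real ^ 'n. 0 < x $ k})" by (auto simp: pos_orthant_def)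
  also have "open \<dots>"
    by (intro open_INT ballI finite open_Collect_less continuous_intros)
  finally show ?thesis .
qed

lemma pos_orthant_segment:
  assumes "x \<in> pos_orthant" "y \<in> pos_orthant" "l \<in> {0<..<1}"
  shows "l *\<^sub>R x + (1 - l) *\<^sub>R y \<in> pos_orthant"
  using assms by (simp add: pos_orthant_def add_pos_pos)

lemma one_in_pos_orthant: "1 \<in> pos_orthant"
  by (simp add: pos_orthant_def)

lemma scaled_one_in_pos_orthant: "t > 0 \<Longrightarrow> t *\<^sub>R 1 \<in> pos_orthant"
  by (simp add: pos_orthant_def)

text \<open>
  This turns convexity inequalities in the extended reals into real inequalities between sums over
  the coordinates.
\<close>

lemma neg_burg_jensen_iff:
  fixes x y :: "real ^ 'n"
  assumes xy: "x \<in> pos_orthant" "y \<in> pos_orthant" and l: "l \<in> {0<..<1}"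
  shows "neg_burg (l *\<^sub>R x + (1 - l) *\<^sub>R y) + ereal c
           \<le> ereal l * neg_burg x + ereal (1 - l) * neg_burg y
         \<longleftrightarrow> c \<le> (\<Sum>k\<in>UNIV. log_gap l (x $ k) (y $ k))"
  using xy pos_orthant_segment[OF xy l]
  by (auto simp: neg_burg_def log_gap_def sum_subtractf sum_distrib_left)

lemma ext_convex_neg_burg: "ext_convex (neg_burg :: real ^ 'n \<Rightarrow> ereal)"
  unfolding ext_convex_def
proof (intro conjI allI ballI)
  fix x :: "real ^ 'n"
  show "neg_burg x \<noteq> - \<infinity>" by (simp add: neg_burg_def)
next
  fix x y :: "real ^ 'n" and l :: real
  assume l: "l \<in> {0<..<1}"
  show "neg_burg (l *\<^sub>R x + (1 - l) *\<^sub>R y) \<le> ereal l * neg_burg x + ereal (1 - l) * neg_burg y"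
  proof (cases "x \<in> pos_orthant \<and> y \<in> pos_orthant")
    case True
    then have "0 \<le> (\<Sum>k\<in>UNIV. log_gap l (x $ k) (y $ k))"
      using l by (intro sum_nonneg log_gap_nonneg) (auto simp: pos_orthant_def)
    with True neg_burg_jensen_iff[of x y l 0] l show ?thesis by (simp flip: zero_ereal_def)
  next
    case False
    then have "ereal l * neg_burg x + ereal (1 - l) * neg_burg y = \<infinity>"
      using l by (auto simp: neg_burg_def)
    then show ?thesis by (simp only: ereal_less_eq)
  qed
qed

lemma ext_strictly_convex_neg_burg:
  "ext_strictly_convex_on (pos_orthant :: (real ^ 'n) set) neg_burg"
  unfolding ext_strictly_convex_on_def
proof (intro ballI impI)
  fix x y :: "real ^ 'n" and l :: real
  assume xy: "x \<in> pos_orthant" "y \<in> pos_orthant" and l: "l \<in> {0<..<1}" and "x \<noteq> y"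
  define c where "c = (\<Sum>k\<in>UNIV. log_gap l (x $ k) (y $ k))"
  obtain j where j: "x $ j \<noteq> y $ j" using \<open>x \<noteq> y\<close> by (auto simp: vec_eq_iff)
  have "c > 0" unfolding c_def
  proof (rule sum_pos2[of _ j])
    show "0 < log_gap l (x $ j) (y $ j)"
      using xy l j by (intro log_gap_pos) (auto simp: pos_orthant_def)
    show "0 \<le> log_gap l (x $ k) (y $ k)" for k
      using xy l by (intro log_gap_nonneg) (auto simp: pos_orthant_def)
  qed auto
  moreover have "neg_burg (l *\<^sub>R x + (1 - l) *\<^sub>R y) + ereal c
      \<le> ereal l * neg_burg x + ereal (1 - l) * neg_burg y"
    using neg_burg_jensen_iff[OF xy l] c_def by simp
  ultimately show "neg_burg (l *\<^sub>R x + (1 - l) *\<^sub>R y)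
      < ereal l * neg_burg x + ereal (1 - l) * neg_burg y"
    using pos_orthant_segment[OF xy l] xy by (auto simp: neg_burg_def)
qed

lemma uniformly_convex_rel_neg_burgI:
  fixes S1 S2 :: "(real ^ 'n) set"
  assumes "S1 \<noteq> {}" "S1 \<subseteq> pos_orthant" "S2 \<noteq> {}" "S2 \<subseteq> pos_orthant"
    and "0 \<le> g 0" "\<And>t. t > 0 \<Longrightarrow> 0 < g t"
    and "\<And>x y l. x \<in> S1 \<Longrightarrow> y \<in> S2 \<Longrightarrow> l \<in> {0<..<1} \<Longrightarrow>
           l * (1 - l) * g (N (x - y)) \<le> (\<Sum>k\<in>UNIV. log_gap l (x $ k) (y $ k))"
  shows "uniformly_convex_rel N neg_burg S1 S2 (\<lambda>t. ereal (g t))"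
  unfolding uniformly_convex_rel_def edom_neg_burg
proof (intro conjI ballI)
  fix x y l assume xyl: "x \<in> S1" "y \<in> S2" "l \<in> {0<..<1::real}"
  then show "neg_burg (l *\<^sub>R x + (1 - l) *\<^sub>R y) + ereal (l * (1 - l)) * ereal (g (N (x - y)))
      \<le> ereal l * neg_burg x + ereal (1 - l) * neg_burg y"
    unfolding times_ereal.simps(1) using assms
    by (subst neg_burg_jensen_iff) auto
qed (use assms ext_convex_neg_burg in auto)

text \<open>
  Coordinates of points of \<open>S\<close> are at most \<open>R = cinf M\<close>, and summing the quadratic lower bounds
  of the coordinate gaps produces the squared Euclidean norm, which \<open>c2\<close> compares with \<open>N\<close>.
\<close>

lemma strongly_convex_neg_burg:
  fixes N :: "real ^ 'n \<Rightarrow> real"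
  assumes N: "is_norm N" and S: "S \<noteq> {}" "S \<subseteq> pos_orthant"
    and M: "0 < M" "\<And>x. x \<in> S \<Longrightarrow> N x \<le> M"
    and c2: "0 < c2" "\<And>v. c2 * N v \<le> norm v"
    and cinf: "0 < cinf" "\<And>v. infnorm v \<le> cinf * N v"
  shows "strongly_convex_on N neg_burg S (c2\<^sup>2 / (cinf\<^sup>2 * M\<^sup>2))"
  unfolding strongly_convex_on_def
proof (intro conjI uniformly_convex_rel_neg_burgI S)
  show "0 < c2\<^sup>2 / (cinf\<^sup>2 * M\<^sup>2)" using M c2 cinf by simp
  then show "0 < 1 / 2 * (c2\<^sup>2 / (cinf\<^sup>2 * M\<^sup>2)) * t\<^sup>2" if "t > 0" for t
    using that by (intro mult_pos_pos) auto
next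
  fix x y l assume xy: "x \<in> S" "y \<in> S" and l: "l \<in> {0<..<1::real}"
  define R where "R = cinf * M"
  have R: "z $ k \<le> R" if "z \<in> S" for z k
  proof -
    have "z $ k \<le> infnorm z" using component_le_infnorm_cart[of z k] by simp
    also have "\<dots> \<le> cinf * N z" by (rule cinf)
    also have "\<dots> \<le> R" unfolding R_def using M(2)[OF that] cinf(1) by simp
    finally show ?thesis .
  qed
  have "(c2 * N (x - y))\<^sup>2 \<le> (norm (x - y))\<^sup>2"
    using c2 norm_nonneg[OF N] by (intro power_mono) auto
  also have "\<dots> = (\<Sum>k\<in>UNIV. (x $ k - y $ k)\<^sup>2)"
    by (simp add: norm_vec_def L2_set_def sum_nonneg)
  finally have "l * (1 - l) * ((c2 * N (x - y))\<^sup>2 / (2 * R\<^sup>2))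
      \<le> l * (1 - l) * ((\<Sum>k\<in>UNIV. (x $ k - y $ k)\<^sup>2) / (2 * R\<^sup>2))"
    using l by (intro mult_left_mono divide_right_mono) auto
  also have "\<dots> = (\<Sum>k\<in>UNIV. l * (1 - l) * ((x $ k - y $ k)\<^sup>2 / (2 * R\<^sup>2)))"
    by (simp add: sum_distrib_left sum_divide_distrib)
  also have "\<dots> \<le> (\<Sum>k\<in>UNIV. log_gap l (x $ k) (y $ k))"
    using xy l S R by (intro sum_mono log_gap_ge_square) (auto simp: pos_orthant_def)
  finally show "l * (1 - l) * (1 / 2 * (c2\<^sup>2 / (cinf\<^sup>2 * M\<^sup>2)) * (N (x - y))\<^sup>2)
      \<le> (\<Sum>k\<in>UNIV. log_gap l (x $ k) (y $ k))"
    by (simp add: R_def power_mult_distrib mult_ac)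
qed auto

text \<open>
  One coordinate suffices, because all gaps are nonnegative.  If \<open>k\<close> maximizes \<open>w\<^sub>k\<close>, the ratio
  \<open>w\<^sub>k / (4 x\<^sub>k)\<close> is at least \<open>a N w\<close> with a constant \<open>a\<close> that depends on \<open>x\<close>, and
  \<open>ln (a T)\<close> exceeds \<open>ln (1 + N x + T) / 4\<close> for large \<open>T\<close>.
\<close>

lemma neg_burg_convex_far_from_point:
  fixes N :: "real ^ 'n \<Rightarrow> real" and x :: "real ^ 'n"
  assumes N: "is_norm N" and x: "x \<in> pos_orthant"
  shows "\<exists>r>0. uniformly_convex_rel N neg_burg {x} {w \<in> pos_orthant. N w > r}
           (\<lambda>t. ereal (1 / 4 * ln (1 + t)))"
proof -
  obtain c C where c: "c > 0" "C > 0" "\<And>v. c * N v \<le> norm v" "\<And>v. norm v \<le> C * N v"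
    by (rule norm_equivalence[OF N], rule that)
  have norm_x: "norm x > 0" using x by (auto simp: pos_orthant_def)
  define n where "n = real CARD('n)"
  have n: "n > 0" by (simp add: n_def)
  define a where "a = c / (4 * n * norm x)"
  have a: "a > 0" using c norm_x n by (simp add: a_def)
  have "\<forall>\<^sub>F T in at_top. 1 / 4 * ln (1 + N x + T) \<le> ln (a * T)"
    using a norm_nonneg[OF N, of x] by real_asymp
  then obtain r0 where r0: "\<And>T. T \<ge> r0 \<Longrightarrow> 1 / 4 * ln (1 + N x + T) \<le> ln (a * T)"
    by (auto simp: eventually_at_top_linorder)
  define r where "r = max r0 1"
  have r: "r > 0" "r0 \<le> r" by (simp_all add: r_def)
  have N1: "N 1 > 0"
    using norm_nonneg[OF N, of 1] norm_zero_iff[OF N, of 1] by (simp add: less_le)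
  have "uniformly_convex_rel N neg_burg {x} {w \<in> pos_orthant. N w > r}
          (\<lambda>t. ereal (1 / 4 * ln (1 + t)))"
  proof (rule uniformly_convex_rel_neg_burgI)
    have "(2 * r / N 1) *\<^sub>R 1 \<in> {w \<in> pos_orthant. N w > r}"
      using r N1 by (simp add: norm_scale[OF N] scaled_one_in_pos_orthant)
    then show "{w \<in> pos_orthant. N w > r} \<noteq> {}" by blast
  next
    fix z w l assume z: "z \<in> {x}" and w: "w \<in> {w \<in> pos_orthant. N w > r}" and l: "l \<in> {0<..<1::real}"
    have "\<exists>j. norm w \<le> n * w $ j"
    proof (rule ccontr)
      assume "\<not> ?thesis"
      then have less: "\<And>j. w $ j < norm w / n" using n by (simp add: field_simps not_le)
      have "norm w \<le> (\<Sum>j\<in>UNIV. \<bar>w $ j\<bar>)" by (rule norm_le_l1_cart)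
      also have "\<dots> = (\<Sum>j\<in>UNIV. w $ j)" using w by (simp add: pos_orthant_def less_imp_le)
      also have "\<dots> < (\<Sum>j\<in>(UNIV::'n set). norm w / n)" by (rule sum_strict_mono) (auto simp: less)
      finally show False using n by (simp add: n_def)
    qed
    then obtain j where j: "norm w \<le> n * w $ j" by blast
    have pos: "0 < x $ k" "0 < w $ k" for k using x w by (auto simp: pos_orthant_def)
    have Nw: "N w > 0" "N w \<ge> r0" using w r by auto
    have "1 / 4 * ln (1 + N (x - w)) \<le> 1 / 4 * ln (1 + N x + N w)"
      using norm_diff_le[OF N, of x w] norm_nonneg[OF N, of "x - w"] by simp
    also have "\<dots> \<le> ln (a * N w)" by (rule r0) (rule Nw)
    also have "\<dots> \<le> ln (w $ j / (4 * x $ j))"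
    proof -
      have "a * N w \<le> norm w / (4 * n * norm x)"
        unfolding a_def using c(3)[of w] norm_x n by (simp add: divide_right_mono)
      also have "\<dots> \<le> n * w $ j / (4 * n * norm x)"
        using j norm_x n by (intro divide_right_mono) auto
      also have "\<dots> = w $ j / (4 * norm x)" using n by simp
      also have "\<dots> \<le> w $ j / (4 * x $ j)"
        using component_le_norm_cart[of x j] pos[of j] norm_x
        by (intro divide_left_mono) auto
      finally show ?thesis using a Nw(1) by (intro ln_mono) auto
    qed
    finally have "l * (1 - l) * (1 / 4 * ln (1 + N (x - w))) \<le> l * (1 - l) * ln (w $ j / (4 * x $ j))"
      using l by (intro mult_left_mono) auto
    also have "\<dots> \<le> log_gap l (x $ j) (w $ j)"
      by (rule log_gap_ge_log[OF l]) (rule pos)+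
    also have "\<dots> \<le> (\<Sum>k\<in>UNIV. log_gap l (x $ k) (w $ k))"
      using l pos by (intro member_le_sum log_gap_nonneg) auto
    finally show "l * (1 - l) * (1 / 4 * ln (1 + N (z - w))) \<le> (\<Sum>k\<in>UNIV. log_gap l (z $ k) (w $ k))"
      using z by simp
  qed (use x in auto)
  with r show ?thesis by blast
qed

text \<open>
  The points \<open>t *\<^sub>R 1\<close> and \<open>(t + 1) *\<^sub>R 1\<close> have the constant distance \<open>N 1\<close>, while their
  midpoint gap is \<open>n\<close> times \<open>ln (t + 1 / 2) - (ln t + ln (t + 1)) / 2\<close>, which tends to \<open>0\<close> as
  \<open>t \<rightarrow> \<infinity>\<close>.
\<close>

lemma neg_burg_not_uniformly_convex:
  fixes N :: "real ^ 'n \<Rightarrow> real"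
  assumes N: "is_norm N"
  shows "\<not> uniformly_convex_on N neg_burg pos_orthant"
proof
  assume "uniformly_convex_on N neg_burg pos_orthant"
  then obtain \<psi> where \<psi>: "uniformly_convex_rel N neg_burg pos_orthant pos_orthant \<psi>"
    by (auto simp: uniformly_convex_on_def)
  have "N 1 > 0"
    using norm_nonneg[OF N, of 1] norm_zero_iff[OF N, of 1] by (simp add: less_le)
  then have "0 < \<psi> (N 1)" using \<psi> by (auto simp: uniformly_convex_rel_def)
  \<comment> \<open>The gauge may take the value \<open>\<infinity>\<close>, so it is first replaced by a smaller positive real.\<close>
  then obtain c where c: "0 < c" "ereal c < \<psi> (N 1)"
    using ereal_dense2[of 0 "\<psi> (N 1)"] by auto
  have le: "1 / 4 * c \<le> real CARD('n) * log_gap (1 / 2) t (t + 1)" if t: "t > 0" for t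
  proof -
    define x y :: "real ^ 'n" where "x = t *\<^sub>R 1" and "y = (t + 1) *\<^sub>R 1"
    have xy: "x \<in> pos_orthant" "y \<in> pos_orthant"
      using t by (simp_all add: x_def y_def scaled_one_in_pos_orthant del: scaleR_one)
    have "y - x = 1" by (simp add: x_def y_def algebra_simps)
    then have "N (x - y) = N 1" using norm_minus_swap[OF N, of x y] by simp
    moreover have "ereal (1 / 4) * ereal c \<le> ereal (1 / 4) * \<psi> (N 1)"
      using c by (intro ereal_mult_left_mono) auto
    moreover have "\<And>l. l \<in> {0<..<1} \<Longrightarrow> neg_burg (l *\<^sub>R x + (1 - l) *\<^sub>R y)
        + ereal (l * (1 - l)) * \<psi> (N (x - y)) \<le> ereal l * neg_burg x + ereal (1 - l) * neg_burg y"
      using \<psi> xy unfolding uniformly_convex_rel_def by blast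
    from this[of "1 / 2"]
    have "neg_burg ((1 / 2) *\<^sub>R x + (1 - 1 / 2) *\<^sub>R y) + ereal (1 / 4) * \<psi> (N (x - y))
        \<le> ereal (1 / 2) * neg_burg x + ereal (1 - 1 / 2) * neg_burg y" by simp
    ultimately have "neg_burg ((1 / 2) *\<^sub>R x + (1 - 1 / 2) *\<^sub>R y) + ereal (1 / 4) * ereal c
        \<le> ereal (1 / 2) * neg_burg x + ereal (1 - 1 / 2) * neg_burg y"
      by (elim order.trans[OF add_left_mono, rotated]) simp
    then have "neg_burg ((1 / 2) *\<^sub>R x + (1 - 1 / 2) *\<^sub>R y) + ereal (1 / 4 * c)
        \<le> ereal (1 / 2) * neg_burg x + ereal (1 - 1 / 2) * neg_burg y" by simp
    then show ?thesis
      by (subst (asm) neg_burg_jensen_iff[OF xy]) (simp_all add: x_def y_def)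
  qed
  have "((\<lambda>t. real CARD('n) * log_gap (1 / 2) t (t + 1)) \<longlongrightarrow> 0) at_top"
    unfolding log_gap_def by (rule tendsto_mult_right_zero) real_asymp
  then have "1 / 4 * c \<le> 0"
    by (rule tendsto_lowerbound) (use le in \<open>auto intro: eventually_mono[OF eventually_gt_at_top[of 0]]\<close>)
  with c show False by simp
qed

section \<open>The Bregman divergence\<close>

lemma has_gateaux_derivative_unique:
  assumes "has_gateaux_derivative N b D y" "has_gateaux_derivative N b E y"
  shows "D = E"
proof
  fix v
  have "ereal (D v) = ereal (E v)"
    using assms unfolding has_gateaux_derivative_def
    by (intro tendsto_unique[of "at (0::real)" "\<lambda>t. (b (y + t *\<^sub>R v) - b y) / ereal t"]) auto
  then show "D v = E v" by simp
qed

text \<open>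
  Near \<open>0\<close> the line \<open>y + t v\<close> stays in the open orthant, so the extended real difference quotient
  agrees with that of a real function of \<open>t\<close>.
\<close>

lemma has_gateaux_derivative_neg_burg:
  fixes N :: "real ^ 'n \<Rightarrow> real"
  assumes N: "is_norm N" and y: "y \<in> pos_orthant"
  shows "has_gateaux_derivative N neg_burg (\<lambda>v. - (\<Sum>k\<in>UNIV. v $ k / y $ k)) y"
  unfolding has_gateaux_derivative_def
proof (intro conjI allI)
  show "\<bar>neg_burg y\<bar> \<noteq> \<infinity>" using y by (simp add: neg_burg_def)
  show "(\<lambda>v. - (\<Sum>k\<in>UNIV. v $ k / y $ k)) \<in> norm_dual N"
    by (intro linear_in_norm_dual[OF N] linearI)
      (simp_all add: add_divide_distrib sum.distrib sum_distrib_left)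
  fix v :: "real ^ 'n"
  let ?f = "\<lambda>t. - (\<Sum>k\<in>UNIV. ln ((y + t *\<^sub>R v) $ k))"
  have yk: "y $ k > 0" for k using y by (simp add: pos_orthant_def)
  have "(?f has_real_derivative - (\<Sum>k\<in>UNIV. v $ k / y $ k)) (at 0)"
    using yk by (auto intro!: derivative_eq_intros simp: less_imp_neq[symmetric])
  then have "((\<lambda>t. (?f t - ?f 0) / t) \<longlongrightarrow> - (\<Sum>k\<in>UNIV. v $ k / y $ k)) (at 0)"
    by (simp add: has_field_derivative_iff)
  then have lim: "((\<lambda>t. ereal ((?f t - ?f 0) / t)) \<longlongrightarrow> ereal (- (\<Sum>k\<in>UNIV. v $ k / y $ k))) (at 0)"
    by (rule tendsto_ereal)
  have "((\<lambda>t. y + t *\<^sub>R v) \<longlongrightarrow> y + 0 *\<^sub>R v) (at 0)" by (intro tendsto_intros)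
  then have "\<forall>\<^sub>F t in at 0. y + t *\<^sub>R v \<in> pos_orthant"
    using topological_tendstoD[OF _ open_pos_orthant] y by fastforce
  moreover have "\<forall>\<^sub>F t in at (0::real). t \<noteq> 0" by (simp add: eventually_at_filter)
  ultimately have "\<forall>\<^sub>F t in at 0. ereal ((?f t - ?f 0) / t) = (neg_burg (y + t *\<^sub>R v) - neg_burg y) / ereal t"
    by eventually_elim (use y in \<open>simp add: neg_burg_def\<close>)
  from Lim_transform_eventually[OF lim this]
  show "((\<lambda>t. (neg_burg (y + t *\<^sub>R v) - neg_burg y) / ereal t)
          \<longlongrightarrow> ereal (- (\<Sum>k\<in>UNIV. v $ k / y $ k))) (at 0)" .
qed

text \<open>
  The Itakura-Saito distance of two positive numbers, as a function of their ratio.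
\<close>

definition itakura_saito :: "real \<Rightarrow> real" where
  "itakura_saito s = s - 1 - ln s"

lemma divergence_neg_burg:
  fixes N :: "real ^ 'n \<Rightarrow> real"
  assumes N: "is_norm N" and xy: "x \<in> pos_orthant" "y \<in> pos_orthant"
  shows "divergence N neg_burg pos_orthant x y = ereal (\<Sum>k\<in>UNIV. itakura_saito (x $ k / y $ k))"
proof -
  have pos: "x $ k > 0" "y $ k > 0" for k using xy by (simp_all add: pos_orthant_def)
  have "gateaux_deriv N neg_burg y = (\<lambda>v. - (\<Sum>k\<in>UNIV. v $ k / y $ k))"
    unfolding gateaux_deriv_def
    using has_gateaux_derivative_neg_burg[OF N xy(2)] has_gateaux_derivative_unique by blast
  then have "divergence N neg_burg pos_orthant x y
      = ereal (\<Sum>k\<in>UNIV. - ln (x $ k) + ln (y $ k) + (x $ k - y $ k) / y $ k)"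
    using xy by (simp add: divergence_def edom_neg_burg neg_burg_def sum.distrib sum_negf sum_subtractf)
  also have "\<dots> = ereal (\<Sum>k\<in>UNIV. itakura_saito (x $ k / y $ k))"
    unfolding ereal.inject
  proof (rule sum.cong[OF refl])
    fix k :: 'n
    show "- ln (x $ k) + ln (y $ k) + (x $ k - y $ k) / y $ k = itakura_saito (x $ k / y $ k)"
      using pos(1)[of k] pos(2)[of k] by (simp add: itakura_saito_def ln_div diff_divide_distrib)
  qed
  finally show ?thesis .
qed

text \<open>
  Apply \<open>ln u \<le> u - 1\<close> at \<open>u = sqrt s\<close> instead of \<open>u = s\<close>: the result is quantitative, where
  \<open>u = s\<close> would only give nonnegativity.
\<close>

lemma itakura_saito_ge_sqrt:
  assumes "s > 0"
  shows "(sqrt s - 1)\<^sup>2 \<le> itakura_saito s"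
proof -
  have "ln s = 2 * ln (sqrt s)" using assms by (simp add: ln_sqrt)
  also have "\<dots> \<le> 2 * (sqrt s - 1)" using assms ln_le_minus_one[of "sqrt s"] by simp
  finally have "s - 1 - 2 * (sqrt s - 1) \<le> itakura_saito s" by (simp add: itakura_saito_def)
  moreover have "s = sqrt s * sqrt s" using assms by simp
  ultimately show ?thesis unfolding power2_eq_square by (simp add: algebra_simps)
qed

lemma itakura_saito_nonneg: "s > 0 \<Longrightarrow> 0 \<le> itakura_saito s"
  using itakura_saito_ge_sqrt[of s] zero_le_power2[of "sqrt s - 1"] by linarith

lemma itakura_saito_le_divergence:
  fixes N :: "real ^ 'n \<Rightarrow> real"
  assumes N: "is_norm N" and xy: "x \<in> pos_orthant" "y \<in> pos_orthant"
    and le: "divergence N neg_burg pos_orthant x y \<le> ereal \<gamma>"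
  shows "itakura_saito (x $ k / y $ k) \<le> \<gamma>"
proof -
  have "itakura_saito (x $ k / y $ k) \<le> (\<Sum>k\<in>UNIV. itakura_saito (x $ k / y $ k))"
    using xy by (intro member_le_sum itakura_saito_nonneg) (auto simp: pos_orthant_def)
  with le show ?thesis by (simp add: divergence_neg_burg[OF N xy])
qed

lemma bounded_pos_orthantI:
  fixes S :: "(real ^ 'n) set"
  assumes "S \<subseteq> pos_orthant" "\<And>x k. x \<in> S \<Longrightarrow> x $ k \<le> B k"
  shows "bounded S"
  unfolding bounded_iff
proof (intro exI ballI)
  fix x assume x: "x \<in> S"
  have "norm x \<le> (\<Sum>k\<in>UNIV. \<bar>x $ k\<bar>)" by (rule norm_le_l1_cart)
  also have "\<dots> = (\<Sum>k\<in>UNIV. x $ k)"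
    using x assms(1) by (intro sum.cong) (auto simp: pos_orthant_def less_imp_le)
  also have "\<dots> \<le> (\<Sum>k\<in>UNIV. B k)" using assms(2)[OF x] by (intro sum_mono)
  finally show "norm x \<le> (\<Sum>k\<in>UNIV. B k)" .
qed

text \<open>
  Since \<open>itakura_saito s \<ge> - 1 - ln s\<close> for \<open>s > 0\<close>, a bound on the divergence keeps the ratios \<open>x\<^sub>k / y\<^sub>k\<close> away from \<open>0\<close>.
\<close>

lemma neg_burg_first_level_bounded:
  fixes N :: "real ^ 'n \<Rightarrow> real"
  assumes N: "is_norm N" and x: "x \<in> pos_orthant"
  shows "bounded {y \<in> pos_orthant. divergence N neg_burg pos_orthant x y \<le> ereal \<gamma>}"
proof (rule bounded_pos_orthantI[where B = "\<lambda>k. x $ k * exp (\<gamma> + 1)"])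
  fix y k
  assume y: "y \<in> {y \<in> pos_orthant. divergence N neg_burg pos_orthant x y \<le> ereal \<gamma>}"
  then have pos: "x $ k > 0" "y $ k > 0" using x by (simp_all add: pos_orthant_def)
  have "x $ k / y $ k - 1 - ln (x $ k / y $ k) \<le> \<gamma>"
    using itakura_saito_le_divergence[OF N x, of y \<gamma> k] y by (simp add: itakura_saito_def)
  moreover have "x $ k / y $ k > 0" using pos by simp
  ultimately have "- ln (x $ k / y $ k) \<le> \<gamma> + 1" by linarith
  then have "ln (y $ k) \<le> ln (x $ k) + (\<gamma> + 1)" using pos by (simp add: ln_div)
  also have "\<dots> = ln (x $ k * exp (\<gamma> + 1))" using pos by (simp add: ln_mult)
  finally show "y $ k \<le> x $ k * exp (\<gamma> + 1)" using pos by simp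
qed auto

text \<open>
  Since \<open>itakura_saito s \<ge> s / 2 - ln 2\<close>, a bound on the divergence bounds the ratios \<open>x\<^sub>k / y\<^sub>k\<close> from above.
\<close>

lemma neg_burg_second_level_bounded:
  fixes N :: "real ^ 'n \<Rightarrow> real"
  assumes N: "is_norm N" and y: "y \<in> pos_orthant"
  shows "bounded {x \<in> pos_orthant. divergence N neg_burg pos_orthant x y \<le> ereal \<gamma>}"
proof (rule bounded_pos_orthantI[where B = "\<lambda>k. 2 * (\<gamma> + ln 2) * y $ k"])
  fix x k
  assume x: "x \<in> {x \<in> pos_orthant. divergence N neg_burg pos_orthant x y \<le> ereal \<gamma>}"
  define s where "s = x $ k / y $ k"
  have pos: "y $ k > 0" "s > 0" using x y by (simp_all add: s_def pos_orthant_def)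
  have "s - 1 - ln s \<le> \<gamma>"
    using itakura_saito_le_divergence[OF N _ y, of x \<gamma> k] x by (simp add: s_def itakura_saito_def)
  moreover have "ln s - ln 2 \<le> s / 2 - 1"
    using ln_le_minus_one[of "s / 2"] pos by (simp add: ln_div)
  ultimately have "s \<le> 2 * (\<gamma> + ln 2)" by simp
  then show "x $ k \<le> 2 * (\<gamma> + ln 2) * y $ k" using pos by (simp add: s_def field_simps)
qed auto

text \<open>
  The function is the supremum of its tangent affine functions \<open>A p\<close> at points \<open>p\<close> of the orthant,
  and these are continuous.  Inside the orthant the supremum is attained at \<open>p = x\<close>.  If some
  \<open>x\<^sub>j \<le> 0\<close>, then \<open>A p x\<close> tends to infinity as \<open>p\<^sub>j \<rightarrow> 0\<close> with the other coordinates of \<open>p\<close> fixed.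
\<close>

lemma ext_lsc_neg_burg:
  fixes N :: "real ^ 'n \<Rightarrow> real"
  assumes N: "is_norm N"
  shows "ext_lsc N neg_burg"
proof -
  define A where "A p z = (\<Sum>k\<in>UNIV. 1 - ln (p $ k) - z $ k / p $ k)" for p z :: "real ^ 'n"
  have minorant: "ereal (A p z) \<le> neg_burg z" if p: "p \<in> pos_orthant" for p z
  proof (cases "z \<in> pos_orthant")
    case True
    have "A p z \<le> (\<Sum>k\<in>UNIV. - ln (z $ k))" unfolding A_def
    proof (rule sum_mono)
      fix k :: 'n
      have "z $ k > 0" "p $ k > 0" using p True by (simp_all add: pos_orthant_def)
      then show "1 - ln (p $ k) - z $ k / p $ k \<le> - ln (z $ k)"
        using itakura_saito_nonneg[of "z $ k / p $ k"] by (simp add: itakura_saito_def ln_div)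
    qed
    then show ?thesis using True by (simp add: neg_burg_def sum_negf)
  qed (simp add: neg_burg_def)
  have attained: "\<exists>p\<in>pos_orthant. a < ereal (A p x)" if a: "a < neg_burg x" for a x
  proof (cases "x \<in> pos_orthant")
    case True
    then have "x $ k \<noteq> 0" for k by (auto simp: pos_orthant_def less_imp_neq[symmetric])
    then have "ereal (A x x) = neg_burg x" using True by (simp add: neg_burg_def A_def sum_negf)
    with a True show ?thesis by (intro bexI[of _ x]) auto
  next
    case False
    then obtain j where j: "x $ j \<le> 0" by (auto simp: pos_orthant_def not_less)
    from a False have "a < \<infinity>" by (simp add: neg_burg_def)
    then obtain c where c: "a \<le> ereal c" by (cases a) auto
    \<comment> \<open>With \<open>p\<^sub>k = 1\<close> for \<open>k \<noteq> j\<close>, the other coordinates contribute \<open>C\<close>; the choice of \<open>p\<^sub>j\<close> makes the rest exceed \<open>c - C\<close>.\<close>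
    define C where "C = (\<Sum>k\<in>UNIV-{j}. 1 - x $ k)"
    define p :: "real ^ 'n" where "p = (\<chi> k. if k = j then exp (C - c) else 1)"
    have p: "p \<in> pos_orthant" by (simp add: p_def pos_orthant_def)
    have "A p x = (1 - ln (p $ j) - x $ j / p $ j) + (\<Sum>k\<in>UNIV-{j}. 1 - ln (p $ k) - x $ k / p $ k)"
      unfolding A_def by (rule sum.remove) auto
    also have "(\<Sum>k\<in>UNIV-{j}. 1 - ln (p $ k) - x $ k / p $ k) = C"
      unfolding C_def by (rule sum.cong) (auto simp: p_def)
    also have "1 - ln (p $ j) - x $ j / p $ j + C = 1 + c - x $ j / exp (C - c)"
      by (simp add: p_def)
    also have "\<dots> > c" using divide_nonpos_pos[OF j, of "exp (C - c)"] exp_gt_zero[of "C - c"] by linarith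
    finally have "ereal c < ereal (A p x)" by simp
    with c p show ?thesis by (meson order.strict_trans1)
  qed
  show ?thesis unfolding ext_lsc_def
  proof (intro allI impI)
    fix x :: "real ^ 'n" and a assume "a < neg_burg x"
    from attained[OF this] obtain p where p: "p \<in> pos_orthant" "a < ereal (A p x)" by blast
    have "p $ k \<noteq> 0" for k using p by (auto simp: pos_orthant_def less_imp_neq[symmetric])
    then have "continuous_on UNIV (\<lambda>z. ereal (A p z))"
      unfolding A_def by (intro continuous_intros) auto
    then have "open {z. a < ereal (A p z)}"
      by (intro open_Collect_less continuous_on_const)
    with p(2) obtain d where "d > 0" "\<And>z. N (z - x) < d \<Longrightarrow> a < ereal (A p z)"
      unfolding norm_open_iff[OF N] by blast
    with minorant[OF p(1)] show "\<exists>d>0. \<forall>z. N (z - x) < d \<longrightarrow> a < neg_burg z"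
      by (meson order.strict_trans2)
  qed
qed

lemma tendsto_divergence_neg_burg:
  fixes N :: "real ^ 'n \<Rightarrow> real"
  assumes N: "is_norm N" and x: "x \<in> pos_orthant" and y: "y \<in> pos_orthant"
    and ys: "\<And>i. ys i \<in> pos_orthant" and lim: "\<And>k. ((\<lambda>i. ys i $ k) \<longlongrightarrow> y $ k) F"
  shows "((\<lambda>i. divergence N neg_burg pos_orthant x (ys i))
           \<longlongrightarrow> divergence N neg_burg pos_orthant x y) F"
proof -
  have pos: "x $ k > 0" "y $ k > 0" for k using x y by (simp_all add: pos_orthant_def)
  have "((\<lambda>i. itakura_saito (x $ k / ys i $ k)) \<longlongrightarrow> itakura_saito (x $ k / y $ k)) F" for k
    unfolding itakura_saito_def using pos(1)[of k] pos(2)[of k]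
    by (intro tendsto_intros lim) auto
  then show ?thesis
    unfolding divergence_neg_burg[OF N x y] divergence_neg_burg[OF N x ys]
    by (intro tendsto_intros) auto
qed

lemma divergence_neg_burg_self:
  fixes N :: "real ^ 'n \<Rightarrow> real"
  assumes "is_norm N" "x \<in> pos_orthant"
  shows "divergence N neg_burg pos_orthant x x = 0"
proof -
  have "x $ k \<noteq> 0" for k using assms by (auto simp: pos_orthant_def less_imp_neq[symmetric])
  then show ?thesis by (simp add: divergence_neg_burg[OF assms(1,2,2)] itakura_saito_def)
qed

text \<open>
  A vanishing divergence sends every ratio \<open>s = x\<^sub>k / y\<^sub>k\<close> to \<open>1\<close>, and
  \<open>x\<^sub>k - y\<^sub>k = y\<^sub>k (s - 1)\<close> then vanishes in the limit because \<open>y\<^sub>k\<close> stays bounded.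
\<close>

lemma neg_burg_sequentially_consistent:
  fixes N :: "real ^ 'n \<Rightarrow> real"
  assumes N: "is_norm N"
  shows "sequentially_consistent N neg_burg pos_orthant"
  unfolding sequentially_consistent_def edom_neg_burg norm_bounded_iff[OF N] norm_tendsto_iff[OF N]
proof (intro allI impI vec_tendstoI, elim conjE)
  fix xs ys :: "nat \<Rightarrow> real ^ 'n" and k :: 'n
  assume "range xs \<subseteq> pos_orthant" "range ys \<subseteq> pos_orthant"
  then have xs: "\<And>i. xs i \<in> pos_orthant" and ys: "\<And>i. ys i \<in> pos_orthant" by auto
  assume bd: "bounded (range ys)"
  assume "(\<lambda>i. divergence N neg_burg pos_orthant (xs i) (ys i)) \<longlonglongrightarrow> 0"
  then have D: "(\<lambda>i. \<Sum>k\<in>UNIV. itakura_saito (xs i $ k / ys i $ k)) \<longlonglongrightarrow> 0"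
    by (simp add: divergence_neg_burg[OF N xs ys] zero_ereal_def)
  have pos: "xs i $ k > 0" "ys i $ k > 0" for i k using xs ys by (simp_all add: pos_orthant_def)
  define s where "s i = xs i $ k / ys i $ k" for i
  have s: "s i > 0" for i by (simp add: s_def pos)
  have "(\<lambda>i. (sqrt (s i) - 1)\<^sup>2) \<longlonglongrightarrow> 0"
  proof (rule tendsto_sandwich[OF _ _ tendsto_const D])
    have "(sqrt (s i) - 1)\<^sup>2 \<le> (\<Sum>k\<in>UNIV. itakura_saito (xs i $ k / ys i $ k))" for i
    proof -
      have "(sqrt (s i) - 1)\<^sup>2 \<le> itakura_saito (xs i $ k / ys i $ k)"
        using itakura_saito_ge_sqrt[OF s[of i]] by (simp add: s_def)
      also have "\<dots> \<le> (\<Sum>k\<in>UNIV. itakura_saito (xs i $ k / ys i $ k))"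
        by (intro member_le_sum itakura_saito_nonneg) (simp_all add: pos)
      finally show ?thesis .
    qed
    then show "\<forall>\<^sub>F i in sequentially. (sqrt (s i) - 1)\<^sup>2
        \<le> (\<Sum>k\<in>UNIV. itakura_saito (xs i $ k / ys i $ k))" by simp
  qed simp
  then have "(\<lambda>i. sqrt (s i) - 1) \<longlonglongrightarrow> 0" by (simp add: power_tendsto_0_iff)
  then have "(\<lambda>i. (sqrt (s i))\<^sup>2) \<longlonglongrightarrow> 1\<^sup>2"
    by (intro tendsto_power) (simp add: LIM_zero_iff)
  then have s1: "(\<lambda>i. s i - 1) \<longlonglongrightarrow> 0" using s by (simp add: LIM_zero_iff less_imp_le)
  obtain B where B: "\<And>i. norm (ys i) \<le> B" using bd by (auto simp: bounded_iff)
  have "(\<lambda>i. B * \<bar>s i - 1\<bar>) \<longlonglongrightarrow> 0"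
    using s1 by (intro tendsto_mult_right_zero tendsto_rabs_zero)
  then show "(\<lambda>i. (xs i - ys i) $ k) \<longlonglongrightarrow> 0 $ k"
    unfolding zero_index
  proof (rule Lim_null_comparison[rotated], intro always_eventually allI)
    fix i
    have "xs i $ k - ys i $ k = ys i $ k * (s i - 1)"
      using pos(2)[of i k] by (simp add: s_def field_simps)
    then have "norm ((xs i - ys i) $ k) = \<bar>ys i $ k\<bar> * \<bar>s i - 1\<bar>" by (simp add: abs_mult)
    also have "\<dots> \<le> B * \<bar>s i - 1\<bar>"
      using component_le_norm_cart[of "ys i" k] B[of i] by (intro mult_right_mono) auto
    finally show "norm ((xs i - ys i) $ k) \<le> B * \<bar>s i - 1\<bar>" .
  qed
qed

lemma neg_burg_bregman_function:
  fixes N :: "real ^ 'n \<Rightarrow> real"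
  assumes N: "is_norm N"
  shows "bregman_function N neg_burg pos_orthant"
  unfolding bregman_function_def edom_neg_burg
proof (intro conjI ballI allI impI; (elim conjE)?)
  show "pos_orthant = norm_topology N interior_of pos_orthant"
    by (simp add: norm_topology_eq_euclidean[OF N] interior_open open_pos_orthant)
  show "pos_orthant \<noteq> {}" using one_in_pos_orthant by blast
  show "\<exists>D. has_gateaux_derivative N neg_burg D y" if "y \<in> pos_orthant" for y
    using has_gateaux_derivative_neg_burg[OF N that] by blast
  show "norm_bounded N {y \<in> pos_orthant. divergence N neg_burg pos_orthant x y \<le> ereal \<gamma>}"
    if "x \<in> pos_orthant" for x \<gamma>
    by (simp add: norm_bounded_iff[OF N] neg_burg_first_level_bounded[OF N that])
next
  fix x and ys :: "nat \<Rightarrow> real ^ 'n"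
  assume x: "x \<in> pos_orthant" and ys: "range ys \<subseteq> pos_orthant" and lim: "(\<lambda>i. N (x - ys i)) \<longlonglongrightarrow> 0"
  from lim have "ys \<longlonglongrightarrow> x"
    unfolding norm_minus_swap[OF N, of x] norm_tendsto_iff[OF N] by (simp add: LIM_zero_iff)
  then have "\<And>k. (\<lambda>i. ys i $ k) \<longlonglongrightarrow> x $ k" by (rule tendsto_vec_nth)
  from tendsto_divergence_neg_burg[OF N x x _ this] ys
  show "(\<lambda>i. divergence N neg_burg pos_orthant x (ys i)) \<longlonglongrightarrow> 0"
    by (auto simp: divergence_neg_burg_self[OF N x])
next
  fix xs ys :: "nat \<Rightarrow> real ^ 'n" and y
  assume xs: "range xs \<subseteq> pos_orthant" and ys: "range ys \<subseteq> pos_orthant"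
    and D: "(\<lambda>i. divergence N neg_burg pos_orthant (xs i) (ys i)) \<longlonglongrightarrow> 0"
    and lim: "(\<lambda>i. N (ys i - y)) \<longlonglongrightarrow> 0"
  have ys_y: "(\<lambda>i. ys i - y) \<longlonglongrightarrow> 0" using lim by (simp add: norm_tendsto_iff[OF N])
  then have "norm_bounded N (range ys)"
    unfolding norm_bounded_iff[OF N] by (intro convergent_imp_bounded) (simp add: LIM_zero_iff)
  then have "(\<lambda>i. xs i - ys i) \<longlonglongrightarrow> 0"
    using neg_burg_sequentially_consistent[OF N] xs ys D
    by (simp add: sequentially_consistent_def edom_neg_burg norm_tendsto_iff[OF N])
  from tendsto_add[OF this ys_y] show "(\<lambda>i. N (xs i - y)) \<longlonglongrightarrow> 0"
    by (simp add: norm_tendsto_iff[OF N])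
qed (use N in \<open>simp_all add: ext_convex_neg_burg ext_lsc_neg_burg ext_strictly_convex_neg_burg\<close>)

lemma neg_burg_limiting_difference:
  fixes N :: "real ^ 'n \<Rightarrow> real"
  assumes N: "is_norm N"
  shows "limiting_difference_property N neg_burg pos_orthant"
  unfolding limiting_difference_property_def edom_neg_burg
proof (intro ballI allI impI, elim conjE)
  fix x y :: "real ^ 'n" and ys :: "nat \<Rightarrow> real ^ 'n"
  assume x: "x \<in> pos_orthant" and y: "y \<in> pos_orthant" and ys: "range ys \<subseteq> pos_orthant"
    and weak: "weakly_converges N ys y"
  have ys': "\<And>i. ys i \<in> pos_orthant" using ys by auto
  have lim: "(\<lambda>i. divergence N neg_burg pos_orthant z (ys i)) \<longlonglongrightarrow> divergence N neg_burg pos_orthant z y"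
    if "z \<in> pos_orthant" for z
    by (rule tendsto_divergence_neg_burg[OF N that y ys' weakly_converges_component[OF N weak]])
  have "(\<lambda>i. divergence N neg_burg pos_orthant x (ys i) - divergence N neg_burg pos_orthant y (ys i))
      \<longlonglongrightarrow> divergence N neg_burg pos_orthant x y - divergence N neg_burg pos_orthant y y"
    by (intro tendsto_diff_ereal lim x y) (simp_all add: divergence_neg_burg[OF N] x y)
  then show "(\<lambda>i. divergence N neg_burg pos_orthant x (ys i) - divergence N neg_burg pos_orthant y (ys i))
      \<longlonglongrightarrow> divergence N neg_burg pos_orthant x y"
    by (simp add: divergence_neg_burg_self[OF N y])
qed

section \<open>The convexity and Bregman properties of the negative Burg entropy\<close>

theorem mainTheorem8:
  fixes N :: "real ^ 'n \<Rightarrow> real"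
  assumes "is_norm N"
  shows
    "(\<forall>S. S \<noteq> {} \<and> norm_bounded N S \<and> closedin (norm_topology N) S \<and> convex S \<and>
          S \<subseteq> pos_orthant \<longrightarrow>
        (\<exists>\<mu>. strongly_convex_on N neg_burg S \<mu>) \<and>
        (\<forall>M c2 cinf::real.
           0 < M \<and> (\<forall>x\<in>S. N x \<le> M) \<and>
           0 < c2 \<and> (\<forall>v::real ^ 'n. c2 * N v \<le> norm v) \<and>
           0 < cinf \<and> (\<forall>v::real ^ 'n. infnorm v \<le> cinf * N v) \<longrightarrow>
           strongly_convex_on N neg_burg S (c2\<^sup>2 / (cinf\<^sup>2 * M\<^sup>2)))) \<and>
     (\<forall>x\<in>pos_orthant. \<exists>r>0.
        uniformly_convex_rel N neg_burg {x} {w \<in> pos_orthant. N w > r}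
          (\<lambda>t. ereal (1 / 4 * ln (1 + t)))) \<and>
     \<not> uniformly_convex_on N neg_burg pos_orthant \<and>
     (bregman_function N neg_burg pos_orthant \<and>
      sequentially_consistent N neg_burg pos_orthant \<and>
      limiting_difference_property N neg_burg pos_orthant \<and>
      (\<forall>y\<in>pos_orthant. \<forall>\<gamma>::real.
         norm_bounded N {x \<in> edom neg_burg. divergence N neg_burg pos_orthant x y \<le> ereal \<gamma>}))"
proof (intro conjI allI ballI impI; (elim conjE)?)
  fix S :: "(real ^ 'n) set"
  assume S: "S \<noteq> {}" "norm_bounded N S" "S \<subseteq> pos_orthant"
  obtain c C where c: "c > 0" "C > 0" "\<And>v. c * N v \<le> norm v" "\<And>v. norm v \<le> C * N v"
    by (rule norm_equivalence[OF assms], rule that)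
  obtain M where M: "\<And>x. x \<in> S \<Longrightarrow> N x \<le> M" using S(2) by (auto simp: norm_bounded_def)
  have "strongly_convex_on N neg_burg S (c\<^sup>2 / (C\<^sup>2 * (max M 1)\<^sup>2))"
  proof (rule strongly_convex_neg_burg[OF assms S(1,3)])
    show "N x \<le> max M 1" if "x \<in> S" for x using M[OF that] by simp
    show "infnorm v \<le> C * N v" for v using infnorm_le_norm[of v] c(4)[of v] by linarith
  qed (use c in auto)
  then show "\<exists>\<mu>. strongly_convex_on N neg_burg S \<mu>" by blast
next
  fix S :: "(real ^ 'n) set" and M c2 cinf :: real
  assume "S \<noteq> {}" "S \<subseteq> pos_orthant" "0 < M" "\<forall>x\<in>S. N x \<le> M" "0 < c2" "\<forall>v. c2 * N v \<le> norm v"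
    "0 < cinf" "\<forall>v. infnorm v \<le> cinf * N v"
  then show "strongly_convex_on N neg_burg S (c2\<^sup>2 / (cinf\<^sup>2 * M\<^sup>2))"
    by (intro strongly_convex_neg_burg[OF assms]) auto
qed (use assms in \<open>simp_all add: neg_burg_convex_far_from_point[simplified] neg_burg_not_uniformly_convex
  neg_burg_bregman_function neg_burg_sequentially_consistent neg_burg_limiting_difference
  edom_neg_burg norm_bounded_iff neg_burg_second_level_bounded\<close>)

end
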